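(* Let $L_2=\langle a,t \mid a^2,\ [t^{i}at^{-i},t^{j}at^{-j}],\ i,j\in\mathbb{Z}\rangle$. The full language of geodesics for $L_2$ with respect to the generating set $\{a,t\}$ is context-free.
   Context: $L_2$ is the lamplighter group, i.e. the wreath product $\mathbb{Z}_2\wr\mathbb{Z}$, where $a$ generates $\mathbb{Z}_2$ and $t$ generates $\mathbb{Z}$. For a group $G$ with finite generating set $X$, words are finite strings over the alphabet $X\cup X^{-1}$ (as a subset of $G$, so for $L_2$ the letters are $a,t,t^{-1}$); a word is geodesic if its length equals the word length (with respect to $X$) of the element it represents. The full language of geodesics is the set of all geodesic words. A language is context-free if it is the set of strings recognized by some pushdown automaton. *)

theory Defs
  imports "HOL-Algebra.Group"
begin

section \<open>Group presentations\<close>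

text \<open>
  A word over the generators and their formal inverses; the letter \<open>(x, True)\<close> stands for
  \<open>x\<close> and \<open>(x, False)\<close> for \<open>x\<inverse>\<close>.
\<close>

type_synonym 'x gword = "('x \<times> bool) list"

definition gword_inv :: "'x gword \<Rightarrow> 'x gword" where
  "gword_inv w = rev (map (\<lambda>(x, e). (x, \<not> e)) w)"

definition gword_power :: "'x \<Rightarrow> int \<Rightarrow> 'x gword" where
  "gword_power x i = replicate (nat \<bar>i\<bar>) (x, 0 \<le> i)"

definition gword_commutator :: "'x gword \<Rightarrow> 'x gword \<Rightarrow> 'x gword" where
  "gword_commutator u v = u @ v @ gword_inv u @ gword_inv v"

text \<open>
  Two words represent the same element of \<open>\<langle>'x | R\<rangle>\<close> iff they are related by finitely many
  insertions and deletions of relators and of trivial pairs. The generating set is the whole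
  type \<open>'x\<close>.
\<close>

inductive pres_eq :: "'x gword set \<Rightarrow> 'x gword \<Rightarrow> 'x gword \<Rightarrow> bool"
  for R :: "'x gword set" where
  pres_refl: "pres_eq R w w"
| pres_sym: "pres_eq R u v \<Longrightarrow> pres_eq R v u"
| pres_trans: "pres_eq R u v \<Longrightarrow> pres_eq R v w \<Longrightarrow> pres_eq R u w"
| pres_cancel: "pres_eq R (u @ [(x, e), (x, \<not> e)] @ v) (u @ v)"
| pres_relator: "r \<in> R \<Longrightarrow> pres_eq R (u @ r @ v) (u @ v)"

definition pres_class :: "'x gword set \<Rightarrow> 'x gword \<Rightarrow> 'x gword set" where
  "pres_class R w = {v. pres_eq R w v}"

definition presented_group :: "'x gword set \<Rightarrow> 'x gword set monoid" where
  "presented_group R =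
     \<lparr>carrier = range (pres_class R),
      mult = (\<lambda>A B. \<Union>u\<in>A. \<Union>v\<in>B. pres_class R (u @ v)),
      one = pres_class R []\<rparr>"

lemma pres_class_eq_iff: "pres_class R u = pres_class R v \<longleftrightarrow> pres_eq R u v"
  unfolding pres_class_def set_eq_iff mem_Collect_eq
  by (metis pres_refl pres_sym pres_trans)

lemma pres_eq_context: "pres_eq R u v \<Longrightarrow> pres_eq R (p @ u @ s) (p @ v @ s)"
proof (induction rule: pres_eq.induct)
  case (pres_cancel u x e v)
  show ?case using pres_eq.pres_cancel[of R "p @ u" x e "v @ s"] by simp
next
  case (pres_relator r u v)
  then show ?case using pres_eq.pres_relator[of r R "p @ u" "v @ s"] by simp
next
  case (pres_refl w)
  show ?case by (rule pres_eq.pres_refl)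
next
  case (pres_sym u v)
  show ?case by (rule pres_eq.pres_sym) fact
next
  case (pres_trans u v w)
  show ?case by (rule pres_eq.pres_trans) fact+
qed

lemma pres_eq_append:
  assumes "pres_eq R u u'" "pres_eq R v v'"
  shows "pres_eq R (u @ v) (u' @ v')"
proof (rule pres_trans)
  show "pres_eq R (u @ v) (u' @ v)" using pres_eq_context[OF assms(1), of "[]" v] by simp
  show "pres_eq R (u' @ v) (u' @ v')" using pres_eq_context[OF assms(2), of u' "[]"] by simp
qed

lemma presented_group_mult:
  "pres_class R u \<otimes>\<^bsub>presented_group R\<^esub> pres_class R v = pres_class R (u @ v)"
proof -
  have "pres_class R (u' @ v') = pres_class R (u @ v)"
    if "u' \<in> pres_class R u" "v' \<in> pres_class R v" for u' v'
  proof -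
    from that have "pres_eq R u u'" "pres_eq R v v'" by (simp_all add: pres_class_def)
    then show ?thesis unfolding pres_class_eq_iff by (intro pres_sym[OF pres_eq_append])
  qed
  moreover have "u \<in> pres_class R u" "v \<in> pres_class R v"
    by (simp_all add: pres_class_def pres_refl)
  ultimately have
    "(\<Union>u'\<in>pres_class R u. \<Union>v'\<in>pres_class R v. pres_class R (u' @ v')) = pres_class R (u @ v)"
    by blast
  then show ?thesis by (simp add: presented_group_def)
qed

lemma presented_group_one: "\<one>\<^bsub>presented_group R\<^esub> = pres_class R []"
  by (simp add: presented_group_def)

lemma presented_group_carrier: "carrier (presented_group R) = range (pres_class R)"
  by (simp add: presented_group_def)

lemma gword_inv_left: "pres_eq R (gword_inv w @ w) []"
proof (induction w)
  case Nil
  show ?case by (simp add: gword_inv_def pres_refl)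
next
  case (Cons l w)
  obtain x e where l: "l = (x, e)" by (cases l)
  have "pres_eq R (gword_inv w @ [(x, \<not> e), (x, \<not> \<not> e)] @ w) (gword_inv w @ w)"
    by (rule pres_cancel)
  from pres_trans[OF this Cons] show ?case by (simp add: gword_inv_def l)
qed

lemma group_presented_group: "group (presented_group R)"
proof (rule groupI)
  fix x assume "x \<in> carrier (presented_group R)"
  then obtain w where w: "x = pres_class R w" by (auto simp: presented_group_carrier)
  have "pres_class R (gword_inv w) \<otimes>\<^bsub>presented_group R\<^esub> x = \<one>\<^bsub>presented_group R\<^esub>"
    by (simp add: w presented_group_mult presented_group_one pres_class_eq_iff gword_inv_left)
  then show "\<exists>y\<in>carrier (presented_group R). y \<otimes>\<^bsub>presented_group R\<^esub> x = \<one>\<^bsub>presented_group R\<^esub>"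
    by (auto simp: presented_group_carrier)
qed (auto simp: presented_group_carrier presented_group_mult presented_group_one)

lemma presented_group_inv:
  "inv\<^bsub>presented_group R\<^esub> pres_class R w = pres_class R (gword_inv w)"
proof (rule group.inv_equality[OF group_presented_group])
  show "pres_class R (gword_inv w) \<otimes>\<^bsub>presented_group R\<^esub> pres_class R w = \<one>\<^bsub>presented_group R\<^esub>"
    by (simp add: presented_group_mult presented_group_one pres_class_eq_iff gword_inv_left)
qed (auto simp: presented_group_carrier)

lemma presented_group_relator: "r \<in> R \<Longrightarrow> pres_class R r = \<one>\<^bsub>presented_group R\<^esub>"
  using pres_relator[of r R "[]" "[]"]
  by (simp add: presented_group_one pres_class_eq_iff)

section \<open>The lamplighter group\<close>

datatype L2_gen = gen_a | gen_t

definition L2_conj_word :: "int \<Rightarrow> L2_gen gword" where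
  "L2_conj_word i = gword_power gen_t i @ [(gen_a, True)] @ gword_power gen_t (- i)"

definition L2_relators :: "L2_gen gword set" where
  "L2_relators =
     insert (gword_power gen_a 2)
       {gword_commutator (L2_conj_word i) (L2_conj_word j) | i j. True}"

definition L2 :: "L2_gen gword set monoid" where
  "L2 = presented_group L2_relators"

definition L2_a :: "L2_gen gword set" where
  "L2_a = pres_class L2_relators [(gen_a, True)]"

definition L2_t :: "L2_gen gword set" where
  "L2_t = pres_class L2_relators [(gen_t, True)]"

section \<open>Geodesics\<close>

text \<open>
  The letters are elements of the group, so a generator that is an involution contributes one
  letter and not two.
\<close>

definition letters :: "('g, 'm) monoid_scheme \<Rightarrow> 'g set \<Rightarrow> 'g set" where
  "letters G X = X \<union> (\<lambda>x. inv\<^bsub>G\<^esub> x) ` X"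

definition word_value :: "('g, 'm) monoid_scheme \<Rightarrow> 'g list \<Rightarrow> 'g" where
  "word_value G w = foldr (mult G) w \<one>\<^bsub>G\<^esub>"

definition word_length :: "('g, 'm) monoid_scheme \<Rightarrow> 'g set \<Rightarrow> 'g \<Rightarrow> nat" where
  "word_length G X g = (LEAST n. \<exists>w\<in>lists (letters G X). word_value G w = g \<and> length w = n)"

definition geodesics :: "('g, 'm) monoid_scheme \<Rightarrow> 'g set \<Rightarrow> 'g list set" where
  "geodesics G X = {w \<in> lists (letters G X). length w = word_length G X (word_value G w)}"

section \<open>Pushdown automata\<close>

text \<open>
  Nondeterministic automata with \<open>\<epsilon>\<close>-moves, accepting by final state. A transition
  \<open>(p, x, Z, q, \<beta>)\<close> reads \<open>x\<close> (nothing if \<open>x = None\<close>) in state \<open>p\<close> with \<open>Z\<close> on top of the stack,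
  replaces \<open>Z\<close> by \<open>\<beta>\<close> and enters state \<open>q\<close>; the head of a stack list is its top.
\<close>

record ('q, 'a, 'z) pda =
  pda_states :: "'q set"
  pda_input :: "'a set"
  pda_stack :: "'z set"
  pda_trans :: "('q \<times> 'a option \<times> 'z \<times> 'q \<times> 'z list) set"
  pda_start :: 'q
  pda_bottom :: 'z
  pda_final :: "'q set"

definition is_pda :: "('q, 'a, 'z) pda \<Rightarrow> bool" where
  "is_pda M \<longleftrightarrow>
     finite (pda_states M) \<and> finite (pda_input M) \<and> finite (pda_stack M) \<and>
     finite (pda_trans M) \<and>
     pda_trans M \<subseteq> pda_states M \<times> (insert None (Some ` pda_input M)) \<times> pda_stack M \<times>
                    pda_states M \<times> lists (pda_stack M) \<and>
     pda_start M \<in> pda_states M \<and> pda_bottom M \<in> pda_stack M \<and> pda_final M \<subseteq> pda_states M"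

inductive pda_step ::
    "('q, 'a, 'z) pda \<Rightarrow> 'q \<times> 'a list \<times> 'z list \<Rightarrow> 'q \<times> 'a list \<times> 'z list \<Rightarrow> bool"
  for M :: "('q, 'a, 'z) pda" where
  read_step: "(p, Some x, Z, q, \<beta>) \<in> pda_trans M \<Longrightarrow>
    pda_step M (p, x # w, Z # \<gamma>) (q, w, \<beta> @ \<gamma>)"
| eps_step: "(p, None, Z, q, \<beta>) \<in> pda_trans M \<Longrightarrow>
    pda_step M (p, w, Z # \<gamma>) (q, w, \<beta> @ \<gamma>)"

definition pda_language :: "('q, 'a, 'z) pda \<Rightarrow> 'a list set" where
  "pda_language M =
     {w. \<exists>q\<in>pda_final M. \<exists>\<gamma>.
           (pda_step M)\<^sup>*\<^sup>* (pda_start M, w, [pda_bottom M]) (q, [], \<gamma>)}"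

text \<open>
  States and stack symbols range over finite sets of natural numbers; since only their
  number matters, this is no restriction.
\<close>

definition context_free :: "'a list set \<Rightarrow> bool" where
  "context_free L \<longleftrightarrow> (\<exists>M :: (nat, 'a, nat) pda. is_pda M \<and> pda_language M = L)"

end

theory Submission
  imports Defs "HOL-Library.Countable"
begin

text \<open>
  An element of the lamplighter group is a pair \<open>(S, k)\<close> of the set of lit lamps and the position
  of the lamplighter, and its word length is
  \<open>|S| + 2 (max (S \<union> {0, k}) - min (S \<union> {0, k})) - |k|\<close>. Each letter changes this number by
  exactly one, so a word is geodesic iff each of its letters increases it, and whether a letter
  does so can be read off \<open>(S, k)\<close>: a lamp may be switched only from off to on; a step away from
  the origin requires that no lamp is lit beyond the current position; a step towards the origin
  requires a lit lamp at the current position or beyond it. A deterministic pushdown automaton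
  decides these conditions: its stack holds the states of the lamps between the lamplighter and
  the origin, and its finite control remembers the side, whether lamps are lit further out on
  this side, and whether lamps are lit on the other side.
\<close>

section \<open>Pushdown automata\<close>

lemmas rtranclp_induct3 =
  rtranclp_induct[of _ "(ax, ay, az)" "(bx, by', bz)", split_rule, consumes 1, case_names refl step]

lemmas converse_rtranclp_induct3 =
  converse_rtranclp_induct[of _ "(ax, ay, az)" "(bx, by', bz)", split_rule, consumes 1,
    case_names refl step]

text \<open>\<open>context_free\<close> asks for states and stack symbols in \<open>nat\<close>, and
  the input letters must be group elements. Renaming lets the automaton be built over tailor-made
  finite types instead.\<close>

definition pda_map ::
    "('q \<Rightarrow> 'p) \<Rightarrow> ('a \<Rightarrow> 'b) \<Rightarrow> ('z \<Rightarrow> 'y) \<Rightarrow> ('q, 'a, 'z) pda \<Rightarrow> ('p, 'b, 'y) pda" where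
  "pda_map f h g M =
     \<lparr>pda_states = f ` pda_states M,
      pda_input = h ` pda_input M,
      pda_stack = g ` pda_stack M,
      pda_trans = (\<lambda>(p, x, Z, q, \<beta>). (f p, map_option h x, g Z, f q, map g \<beta>)) ` pda_trans M,
      pda_start = f (pda_start M),
      pda_bottom = g (pda_bottom M),
      pda_final = f ` pda_final M\<rparr>"

lemma pda_map_trans:
  "(p', y, Z', q', \<beta>') \<in> pda_trans (pda_map f h g M) \<longleftrightarrow>
    (\<exists>p x Z q \<beta>. (p, x, Z, q, \<beta>) \<in> pda_trans M \<and>
      p' = f p \<and> y = map_option h x \<and> Z' = g Z \<and> q' = f q \<and> \<beta>' = map g \<beta>)"
  by (simp add: pda_map_def image_iff Bex_def)

lemma is_pda_map:
  assumes "is_pda M"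
  shows "is_pda (pda_map f h g M)"
proof -
  have "pda_trans M \<subseteq> pda_states M \<times> insert None (Some ` pda_input M) \<times> pda_stack M \<times>
      pda_states M \<times> lists (pda_stack M)"
    using assms by (simp add: is_pda_def)
  then have "pda_trans (pda_map f h g M) \<subseteq> f ` pda_states M \<times>
      insert None (Some ` h ` pda_input M) \<times> g ` pda_stack M \<times> f ` pda_states M \<times>
      lists (g ` pda_stack M)"
    by (fastforce simp: pda_map_def)
  with assms show ?thesis
    by (auto simp: is_pda_def pda_map_def)
qed

lemma pda_map_step:
  assumes "pda_step M (p, w, \<gamma>) (q, v, \<delta>)"
  shows "pda_step (pda_map f h g M) (f p, map h w, map g \<gamma>) (f q, map h v, map g \<delta>)"
  using assms
proof cases
  case (read_step x Z \<beta> \<gamma>')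
  then have "(f p, Some (h x), g Z, f q, map g \<beta>) \<in> pda_trans (pda_map f h g M)"
    by (force simp: pda_map_def)
  from pda_step.read_step[OF this] read_step show ?thesis by simp
next
  case (eps_step Z \<beta> \<gamma>')
  then have "(f p, None, g Z, f q, map g \<beta>) \<in> pda_trans (pda_map f h g M)"
    by (force simp: pda_map_def)
  from pda_step.eps_step[OF this] eps_step show ?thesis by simp
qed

lemma pda_map_steps:
  assumes "(pda_step M)\<^sup>*\<^sup>* (p, w, \<gamma>) (q, v, \<delta>)"
  shows "(pda_step (pda_map f h g M))\<^sup>*\<^sup>* (f p, map h w, map g \<gamma>) (f q, map h v, map g \<delta>)"
  using assms
proof (induction rule: rtranclp_induct3)
  case refl
  show ?case by simp
next
  case (step q v \<delta> q' v' \<delta>')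
  from step.IH pda_map_step[OF step.hyps(2)] show ?case by (rule rtranclp.rtrancl_into_rtrancl)
qed

text \<open>As \<open>h\<close> may identify letters, the remaining input \<open>v\<close> has no
  canonical preimage. The lifted step therefore fixes only the consumed part \<open>y\<close>, of
  length at most one, and holds for every continuation \<open>w\<close>.\<close>

lemma pda_map_step_lift:
  assumes "inj f" "inj g"
    and "pda_step (pda_map f h g M) (f p, u, map g \<gamma>) (q', v, \<delta>')"
  obtains q \<delta> y where "q' = f q" "\<delta>' = map g \<delta>" "u = map h y @ v"
    "\<forall>w. pda_step M (p, y @ w, \<gamma>) (q, w, \<delta>)"
  using assms(3)
proof cases
  case (read_step x' Z' \<beta>' \<gamma>')
  from read_step(4) obtain p0 y Z q \<beta> where y: "(p0, y, Z, q, \<beta>) \<in> pda_trans M"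
    "Some x' = map_option h y" and eqs: "f p = f p0" "Z' = g Z" "q' = f q" "\<beta>' = map g \<beta>"
    unfolding pda_map_trans by blast
  then obtain x where tr: "(p, Some x, Z, q, \<beta>) \<in> pda_trans M" and x: "x' = h x"
    using assms(1) by (cases y) (auto simp: inj_eq)
  from read_step(2) obtain \<gamma>0 where g0: "\<gamma> = Z # \<gamma>0" "\<gamma>' = map g \<gamma>0"
    using eqs assms(2) by (cases \<gamma>) (auto simp: inj_eq)
  show ?thesis
  proof (rule that)
    show "q' = f q" "\<delta>' = map g (\<beta> @ \<gamma>0)" "u = map h [x] @ v"
      using read_step(1,3) eqs g0 x by simp_all
    show "\<forall>w. pda_step M (p, [x] @ w, \<gamma>) (q, w, \<beta> @ \<gamma>0)"
      using pda_step.read_step[OF tr] g0 by simp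
  qed
next
  case (eps_step Z' \<beta>' \<gamma>')
  from eps_step(4) obtain p0 Z q \<beta> where "(p0, None, Z, q, \<beta>) \<in> pda_trans M"
    and eqs: "f p = f p0" "Z' = g Z" "q' = f q" "\<beta>' = map g \<beta>"
    unfolding pda_map_trans by auto
  then have tr: "(p, None, Z, q, \<beta>) \<in> pda_trans M"
    using assms(1) by (simp add: inj_eq)
  from eps_step(1) obtain \<gamma>0 where g0: "\<gamma> = Z # \<gamma>0" "\<gamma>' = map g \<gamma>0"
    using eqs assms(2) by (cases \<gamma>) (auto simp: inj_eq)
  show ?thesis
  proof (rule that)
    show "q' = f q" "\<delta>' = map g (\<beta> @ \<gamma>0)" "u = map h [] @ v"
      using eps_step(2,3) eqs g0 by simp_all
    show "\<forall>w. pda_step M (p, [] @ w, \<gamma>) (q, w, \<beta> @ \<gamma>0)"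
      using pda_step.eps_step[OF tr] g0 by simp
  qed
qed

text \<open>The run is lifted backwards from its end, where the input is empty; each step prepends
  the letters it reads, taken from the original transition.\<close>

lemma pda_map_steps_lift:
  assumes "inj f" "inj g"
    and "(pda_step (pda_map f h g M))\<^sup>*\<^sup>* (f p, u, map g \<gamma>) (q', [], \<delta>')"
  shows "\<exists>w q \<delta>. u = map h w \<and> q' = f q \<and> (pda_step M)\<^sup>*\<^sup>* (p, w, \<gamma>) (q, [], \<delta>)"
proof -
  have "\<forall>p \<gamma>. p' = f p \<longrightarrow> \<gamma>' = map g \<gamma> \<longrightarrow>
      (\<exists>w q \<delta>. u = map h w \<and> q' = f q \<and> (pda_step M)\<^sup>*\<^sup>* (p, w, \<gamma>) (q, [], \<delta>))"
    if "(pda_step (pda_map f h g M))\<^sup>*\<^sup>* (p', u, \<gamma>') (q', [], \<delta>')" for p' \<gamma>'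
    using that
  proof (induction rule: converse_rtranclp_induct3)
    case refl
    show ?case by auto
  next
    case (step p' u \<gamma>' p1' u1 \<gamma>1')
    show ?case
    proof (intro allI impI)
      fix p \<gamma> assume eqs: "p' = f p" "\<gamma>' = map g \<gamma>"
      from step.hyps(1) have "pda_step (pda_map f h g M) (f p, u, map g \<gamma>) (p1', u1, \<gamma>1')"
        by (simp add: eqs)
      then obtain p1 \<gamma>1 y where 1: "p1' = f p1" "\<gamma>1' = map g \<gamma>1" "u = map h y @ u1"
        "\<forall>w. pda_step M (p, y @ w, \<gamma>) (p1, w, \<gamma>1)"
        by (rule pda_map_step_lift[OF assms(1,2)])
      from step.IH 1(1,2) obtain w q \<delta> where 2: "u1 = map h w" "q' = f q"
        "(pda_step M)\<^sup>*\<^sup>* (p1, w, \<gamma>1) (q, [], \<delta>)"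
        by blast
      have "(pda_step M)\<^sup>*\<^sup>* (p, y @ w, \<gamma>) (q, [], \<delta>)"
        using 1(4)[rule_format] 2(3) by (rule converse_rtranclp_into_rtranclp)
      moreover have "u = map h (y @ w)" using 1 2 by simp
      ultimately show "\<exists>w q \<delta>. u = map h w \<and> q' = f q \<and>
          (pda_step M)\<^sup>*\<^sup>* (p, w, \<gamma>) (q, [], \<delta>)"
        using 2(2) by blast
    qed
  qed
  from this[OF assms(3)] show ?thesis by blast
qed

lemma pda_language_map:
  assumes "inj f" "inj g"
  shows "pda_language (pda_map f h g M) = map h ` pda_language M"
proof (intro equalityI subsetI)
  fix u assume "u \<in> pda_language (pda_map f h g M)"
  then obtain q' \<delta>' where q': "q' \<in> f ` pda_final M"
    and "(pda_step (pda_map f h g M))\<^sup>*\<^sup>* (f (pda_start M), u, map g [pda_bottom M]) (q', [], \<delta>')"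
    by (auto simp: pda_language_def pda_map_def)
  from pda_map_steps_lift[OF assms this(2)] obtain w q \<delta> where w: "u = map h w" "q' = f q"
    "(pda_step M)\<^sup>*\<^sup>* (pda_start M, w, [pda_bottom M]) (q, [], \<delta>)"
    by blast
  moreover have "q \<in> pda_final M" using q' w(2) assms(1) by (auto simp: inj_eq)
  ultimately show "u \<in> map h ` pda_language M" by (auto simp: pda_language_def)
next
  fix u assume "u \<in> map h ` pda_language M"
  then obtain w q \<delta> where u: "u = map h w" and q: "q \<in> pda_final M"
    and "(pda_step M)\<^sup>*\<^sup>* (pda_start M, w, [pda_bottom M]) (q, [], \<delta>)"
    by (auto simp: pda_language_def)
  from pda_map_steps[OF this(3), of f h g] q
  show "u \<in> pda_language (pda_map f h g M)"
    unfolding pda_language_def u by (auto simp: pda_map_def)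
qed

text \<open>Countable types embed into \<open>nat\<close> by \<open>to_nat\<close>, which serves for
  both states and stack symbols.\<close>

lemma context_free_map:
  fixes M :: "('q::countable, 'a, 'z::countable) pda"
  assumes "is_pda M"
  shows "context_free (map h ` pda_language M)"
  unfolding context_free_def
  using is_pda_map[OF assms] pda_language_map[OF inj_to_nat inj_to_nat, of h M] by blast

section \<open>Lamp configurations\<close>

datatype lamp_letter = Switch | Step bool

lemma UNIV_lamp_letter: "(UNIV :: lamp_letter set) = insert Switch (range Step)"
  by (auto intro: lamp_letter.exhaust)

type_synonym lamps = "int set \<times> int"

text \<open>Multiplying positions by this sign turns side \<open>b\<close> into the positive one, so
  a single argument covers both directions.\<close>

definition dir :: "bool \<Rightarrow> int" where
  "dir b = (if b then 1 else - 1)"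

lemma dir_simps [simp]:
  "dir True = 1" "dir False = - 1" "dir (\<not> b) = - dir b" "dir b * dir b = 1"
  "dir b * (dir b * x) = x" "dir b \<noteq> 0"
  by (auto simp: dir_def)

fun act :: "lamps \<Rightarrow> lamp_letter \<Rightarrow> lamps" where
  "act (S, k) Switch = (if k \<in> S then S - {k} else insert k S, k)"
| "act (S, k) (Step b) = (S, k + dir b)"

fun opposite :: "lamp_letter \<Rightarrow> lamp_letter" where
  "opposite Switch = Switch"
| "opposite (Step b) = Step (\<not> b)"

lemma act_opposite [simp]: "act (act s x) (opposite x) = s"
  by (cases s; cases x) auto

lemma finite_act [simp]: "finite (fst (act s x)) \<longleftrightarrow> finite (fst s)"
  by (cases s; cases x) auto

lemma finite_run [simp]: "finite (fst (foldl act s w)) \<longleftrightarrow> finite (fst s)"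
  by (induction w arbitrary: s) auto

text \<open>This is \<open>max (S \<union> {0, k})\<close> for \<open>True\<close> and
  \<open>- min (S \<union> {0, k})\<close> for \<open>False\<close>; the sum of both is the span in
  the length formula.\<close>

definition reach :: "bool \<Rightarrow> lamps \<Rightarrow> int" where
  "reach b s = Max ((*) (dir b) ` insert 0 (insert (snd s) (fst s)))"

definition len :: "lamps \<Rightarrow> int" where
  "len s = int (card (fst s)) + 2 * (reach True s + reach False s) - \<bar>snd s\<bar>"

text \<open>At the origin both directions count as leading away from it.\<close>

fun allowed :: "lamps \<Rightarrow> lamp_letter \<Rightarrow> bool" where
  "allowed (S, k) Switch \<longleftrightarrow> k \<notin> S"
| "allowed (S, k) (Step b) \<longleftrightarrow>
     (if 0 \<le> dir b * k then \<forall>s\<in>S. dir b * s \<le> dir b * k else \<exists>s\<in>S. dir b * s \<le> dir b * k)"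

section \<open>Change of the length under one letter\<close>

lemma reach_le_iff:
  "finite S \<Longrightarrow> reach b (S, k) \<le> x \<longleftrightarrow> 0 \<le> x \<and> dir b * k \<le> x \<and> (\<forall>s\<in>S. dir b * s \<le> x)"
  by (auto simp: reach_def)

lemma reach_nonneg: "finite S \<Longrightarrow> 0 \<le> reach b (S, k)"
  and reach_ge: "finite S \<Longrightarrow> dir b * k \<le> reach b (S, k)"
  and reach_ge_lamp: "finite S \<Longrightarrow> s \<in> S \<Longrightarrow> dir b * s \<le> reach b (S, k)"
  using reach_le_iff[of S b k "reach b (S, k)"] by simp_all

lemma reach_eqI:
  assumes "finite S" "0 \<le> x" "dir b * k \<le> x" "\<And>s. s \<in> S \<Longrightarrow> dir b * s \<le> x"
    and "x = 0 \<or> x = dir b * k \<or> (\<exists>s\<in>S. x = dir b * s)"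
  shows "reach b (S, k) = x"
  unfolding reach_def using assms by (intro Max_eqI) auto

lemma len_dir:
  "len (S, k) = int (card S) + 2 * (reach b (S, k) + reach (\<not> b) (S, k)) - \<bar>dir b * k\<bar>"
  by (cases b) (auto simp: len_def)

text \<open>The front extreme moves only if the lamplighter already stands on it; otherwise the
  origin or a lit lamp lies further ahead.\<close>

lemma reach_step:
  assumes "finite S"
  shows "reach b (S, k + dir b) =
    (if 0 \<le> dir b * k \<and> (\<forall>s\<in>S. dir b * s \<le> dir b * k) then dir b * k + 1 else reach b (S, k))"
proof (cases "0 \<le> dir b * k \<and> (\<forall>s\<in>S. dir b * s \<le> dir b * k)")
  case True
  then show ?thesis using assms by (auto simp: distrib_left intro!: reach_eqI)
next
  case False
  have "dir b * k + 1 \<le> reach b (S, k)"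
  proof (cases "0 \<le> dir b * k")
    case True
    with False obtain s where "s \<in> S" "dir b * k < dir b * s" by force
    with reach_ge_lamp[OF assms, of s b k] show ?thesis by linarith
  qed (use reach_nonneg[OF assms, of b k] in linarith)
  then have "reach b (S, k + dir b) \<le> reach b (S, k)"
    using assms by (auto simp: reach_le_iff distrib_left reach_nonneg reach_ge_lamp)
  moreover have "reach b (S, k) \<le> reach b (S, k + dir b)"
    using assms reach_ge[OF assms, of b "k + dir b"]
    by (auto simp: reach_le_iff distrib_left reach_nonneg reach_ge_lamp)
  ultimately show ?thesis using False by auto
qed

text \<open>The rear extreme recedes only if the lamplighter alone attains it, strictly beyond the
  origin and all lit lamps.\<close>

lemma reach_step_back:
  assumes "finite S"
  shows "reach (\<not> b) (S, k + dir b) =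
    (if 0 \<le> dir b * k \<or> (\<exists>s\<in>S. dir b * s \<le> dir b * k) then reach (\<not> b) (S, k)
     else reach (\<not> b) (S, k) - 1)"
proof (cases "0 \<le> dir b * k \<or> (\<exists>s\<in>S. dir b * s \<le> dir b * k)")
  case True
  have "- (dir b * k) \<le> reach (\<not> b) (S, k + dir b)"
    using True
  proof
    assume "0 \<le> dir b * k"
    with reach_nonneg[OF assms, of "\<not> b" "k + dir b"] show ?thesis by linarith
  next
    assume "\<exists>s\<in>S. dir b * s \<le> dir b * k"
    then obtain s where "s \<in> S" "dir b * s \<le> dir b * k" by blast
    with reach_ge_lamp[OF assms, of s "\<not> b" "k + dir b"] show ?thesis by simp
  qed
  then have "reach (\<not> b) (S, k) \<le> reach (\<not> b) (S, k + dir b)"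
    using assms reach_ge_lamp[OF assms, of _ "\<not> b" "k + dir b"]
    by (simp add: reach_le_iff reach_nonneg)
  moreover have "reach (\<not> b) (S, k + dir b) \<le> reach (\<not> b) (S, k)"
    using assms reach_ge[OF assms, of "\<not> b" k] reach_ge_lamp[OF assms, of _ "\<not> b" k]
    by (simp add: reach_le_iff reach_nonneg distrib_left)
  ultimately show ?thesis using True by simp
next
  case False
  then have "reach (\<not> b) (S, k) = - (dir b * k)"
    using assms by (intro reach_eqI) force+
  moreover have "reach (\<not> b) (S, k + dir b) = - (dir b * k) - 1"
    using assms False by (intro reach_eqI) (force simp: distrib_left)+
  ultimately show ?thesis using False by simp
qed

text \<open>Switching changes only the cardinality, since \<open>k\<close> counts in the reaches
  anyway. A step away from the origin adds 1 to \<open>\<bar>k\<bar>\<close> and 1 or 0 to the front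
  reach, a total of \<open>2 - 1\<close> or \<open>0 - 1\<close>; a step towards it takes 1 from
  \<open>\<bar>k\<bar>\<close> and 0 or 1 from the rear reach, a total of \<open>1\<close> or
  \<open>1 - 2\<close>.\<close>

lemma len_act:
  assumes "finite (fst s)"
  shows "len (act s x) = len s + (if allowed s x then 1 else - 1)"
proof (cases x)
  case Switch
  obtain S k where s: "s = (S, k)" by (cases s)
  have "reach b (act s x) = reach b s" for b
    by (auto simp: s Switch reach_def intro: arg_cong[where f = Max])
  moreover have "int (card (S - {k})) = int (card S) - 1" if "k \<in> S"
    using assms that card.remove[of S k] by (simp add: s)
  ultimately show ?thesis
    using assms by (auto simp: s Switch len_def)
next
  case (Step b)
  obtain S k where s: "s = (S, k)" by (cases s)
  have fin: "finite S" using assms by (simp add: s)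
  have eq: "reach b (S, k) = dir b * k" if "0 \<le> dir b * k" "\<forall>s\<in>S. dir b * s \<le> dir b * k"
    using that fin by (intro reach_eqI) auto
  have "dir b * (k + dir b) = dir b * k + 1" by (simp add: distrib_left)
  then show ?thesis
    using eq reach_step[OF fin, of b k] reach_step_back[OF fin, of b k]
    by (auto simp: s Step len_dir[of _ _ b])
qed

section \<open>Shortest words leading to a configuration\<close>

lemma len_pos:
  assumes "finite S" "(S, k) \<noteq> ({}, 0)"
  shows "0 < len (S, k)"
proof -
  have "\<bar>k\<bar> \<le> reach True (S, k) + reach False (S, k)"
    using reach_ge[OF assms(1), of True k] reach_ge[OF assms(1), of False k]
      reach_nonneg[OF assms(1), of True k] reach_nonneg[OF assms(1), of False k] by auto
  moreover have "0 < card S" if "S \<noteq> {}" using assms that by (simp add: card_gt_0_iff)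
  ultimately show ?thesis using assms by (cases "S = {}") (auto simp: len_def)
qed

lemma len_origin [simp]: "len ({}, 0) = 0"
  by (simp add: len_def reach_def)

text \<open>Away from the origin, both steps being allowed puts a lit lamp exactly at
  \<open>k\<close>, which forbids \<open>Switch\<close>. At the origin they leave only the lamp at
  0, and \<open>Switch\<close> requires it to be off.\<close>

lemma ex_not_allowed:
  assumes "s \<noteq> ({}, 0)"
  shows "\<exists>x. \<not> allowed s x"
proof (rule ccontr)
  obtain S k where s: "s = (S, k)" by (cases s)
  assume "\<nexists>x. \<not> allowed s x"
  then have all: "allowed s Switch" "allowed s (Step True)" "allowed s (Step False)" by auto
  show False
  proof (cases "k = 0")
    case True
    with all have "S \<subseteq> {0}" "0 \<notin> S" by (force simp: s)+
    with assms True s show False by auto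
  next
    case False
    with all show False by (fastforce simp: s split: if_splits)
  qed
qed

text \<open>Forbidden letters shorten the configuration, so following them descends to the origin;
  undoing the descent by opposite letters spells the word.\<close>

lemma ex_word_of_len:
  assumes "finite (fst s)"
  shows "\<exists>w. foldl act ({}, 0) w = s \<and> int (length w) = len s"
  using assms
proof (induction "nat (len s)" arbitrary: s rule: less_induct)
  case less
  show ?case
  proof (cases "s = ({}, 0)")
    case True
    then show ?thesis by (intro exI[of _ "[]"]) simp
  next
    case False
    obtain x where x: "\<not> allowed s x" using ex_not_allowed[OF False] by blast
    have len: "len (act s x) = len s - 1" using len_act[OF less.prems, of x] x by simp
    have "0 < len s" using len_pos[of "fst s" "snd s"] less.prems False by simp
    with len have "nat (len (act s x)) < nat (len s)" by simp
    from less.hyps[OF this] less.prems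
    obtain w where "foldl act ({}, 0) w = act s x" "int (length w) = len (act s x)" by auto
    then show ?thesis using len by (intro exI[of _ "w @ [opposite x]"]) simp
  qed
qed

fun admissible :: "lamps \<Rightarrow> lamp_letter list \<Rightarrow> bool" where
  "admissible s [] \<longleftrightarrow> True"
| "admissible s (x # w) \<longleftrightarrow> allowed s x \<and> admissible (act s x) w"

text \<open>Each letter contributes 1 or -1, so the bound is attained exactly when every letter
  contributes 1.\<close>

lemma len_run:
  assumes "finite (fst s)"
  shows "len (foldl act s w) \<le> len s + int (length w)"
    and "len (foldl act s w) = len s + int (length w) \<longleftrightarrow> admissible s w"
proof -
  have "len (foldl act s w) \<le> len s + int (length w) \<and>
      (len (foldl act s w) = len s + int (length w) \<longleftrightarrow> admissible s w)"
    using assms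
  proof (induction w arbitrary: s)
    case Nil
    show ?case by simp
  next
    case (Cons x w)
    from Cons.IH[of "act s x"] Cons.prems len_act[OF Cons.prems, of x] show ?case
      by (auto split: if_splits)
  qed
  then show "len (foldl act s w) \<le> len s + int (length w)"
    and "len (foldl act s w) = len s + int (length w) \<longleftrightarrow> admissible s w" by blast+
qed

section \<open>The automaton\<close>

text \<open>
  In \<open>Going b i e\<close> the lamplighter is on the side \<open>b\<close>; \<open>i\<close> means that lamps are lit further out
  on this side, and \<open>e\<close> that lamps are lit on the other side.
\<close>

datatype mode = Start | Going bool bool bool

lemma UNIV_mode: "(UNIV :: mode set) = insert Start (range (\<lambda>(b, i, e). Going b i e))"
proof -
  have "m \<in> insert Start (range (\<lambda>(b, i, e). Going b i e))" for m
  proof (cases m)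
    case (Going b i e)
    then show ?thesis by (intro insertI2 range_eqI[of _ _ "(b, i, e)"]) simp
  qed simp
  then show ?thesis by blast
qed

instance mode :: finite
  by standard (simp add: UNIV_mode)

text \<open>A stack symbol tells whether the lamp is lit and whether it is the one at the origin.\<close>

fun delta :: "mode \<Rightarrow> lamp_letter \<Rightarrow> bool \<times> bool \<Rightarrow> (mode \<times> (bool \<times> bool) list) option" where
  "delta q Switch (l, z) = (if l then None else Some (q, [(True, z)]))"
| "delta Start (Step c) Z = Some (Going c False False, [(False, False), Z])"
| "delta (Going b i e) (Step c) (l, z) =
     (if c = b then if i then None else Some (Going b False e, [(False, False), (l, z)])
      else if z then if e then None else Some (Going c False True, [(False, False), (l, z)])
      else if i \<or> l then Some (Going b True e, []) else None)"

text \<open>All states are final because rejection means getting stuck on a forbidden letter.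
  \<open>the\<close> is applied only where \<open>delta\<close> is defined.\<close>

definition lamp_pda :: "(mode, lamp_letter, bool \<times> bool) pda" where
  "lamp_pda =
     \<lparr>pda_states = UNIV,
      pda_input = UNIV,
      pda_stack = UNIV,
      pda_trans = (\<lambda>(q, x, Z). (q, Some x, Z, the (delta q x Z))) ` {(q, x, Z). delta q x Z \<noteq> None},
      pda_start = Start,
      pda_bottom = (False, True),
      pda_final = UNIV\<rparr>"

lemma lamp_pda_trans:
  "(p, y, Z, q, \<beta>) \<in> pda_trans lamp_pda \<longleftrightarrow> (\<exists>x. y = Some x \<and> delta p x Z = Some (q, \<beta>))"
proof
  assume "\<exists>x. y = Some x \<and> delta p x Z = Some (q, \<beta>)"
  then obtain x where "y = Some x" "delta p x Z = Some (q, \<beta>)" by blast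
  then show "(p, y, Z, q, \<beta>) \<in> pda_trans lamp_pda"
    by (auto simp: lamp_pda_def simp del: delta.simps intro!: rev_image_eqI[of "(p, x, Z)"])
qed (auto simp: lamp_pda_def simp del: delta.simps)

lemma is_pda_lamp_pda: "is_pda lamp_pda"
proof -
  have "finite (UNIV :: lamp_letter set)" by (simp add: UNIV_lamp_letter)
  moreover from this have "finite (UNIV :: (mode \<times> lamp_letter \<times> bool \<times> bool) set)"
    by (simp add: finite_prod)
  then have "finite (pda_trans lamp_pda)"
    unfolding lamp_pda_def by (auto intro: finite_subset[OF subset_UNIV])
  moreover have "pda_trans lamp_pda \<subseteq> UNIV \<times> insert None (range Some) \<times> UNIV \<times> UNIV \<times> lists UNIV"
    by (auto simp: lamp_pda_trans)
  ultimately show ?thesis by (simp add: is_pda_def lamp_pda_def)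
qed

section \<open>The invariant linking automaton and configuration\<close>

fun lamp_stack :: "int set \<Rightarrow> bool \<Rightarrow> nat \<Rightarrow> (bool \<times> bool) list" where
  "lamp_stack S b 0 = [(0 \<in> S, True)]"
| "lamp_stack S b (Suc n) = (dir b * int (Suc n) \<in> S, False) # lamp_stack S b n"

lemma lamp_stack_cong:
  "(\<And>j. j \<le> n \<Longrightarrow> dir b * int j \<in> S \<longleftrightarrow> dir b * int j \<in> S') \<Longrightarrow>
   lamp_stack S b n = lamp_stack S' b n"
  by (induction n) force+

lemma lamp_stack_insert:
  "lamp_stack S b n = (l, z) # \<gamma> \<Longrightarrow>
   lamp_stack (insert (dir b * int n) S) b n = (True, z) # \<gamma>"
  by (cases n) (auto intro!: lamp_stack_cong)

text \<open>The condition \<open>n \<noteq> 0\<close> records that a return to the origin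
  presupposes a lit lamp on side \<open>b\<close>, hence \<open>i\<close>. The origin with no lamp
  lit elsewhere belongs to \<open>Start\<close>.\<close>

fun tracks :: "mode \<Rightarrow> (bool \<times> bool) list \<Rightarrow> lamps \<Rightarrow> bool" where
  "tracks Start \<gamma> (S, k) \<longleftrightarrow> k = 0 \<and> S \<subseteq> {0} \<and> \<gamma> = lamp_stack S True 0"
| "tracks (Going b i e) \<gamma> (S, k) \<longleftrightarrow>
     (\<exists>n. k = dir b * int n \<and> \<gamma> = lamp_stack S b n \<and>
       (if i then \<exists>s\<in>S. int n < dir b * s else n \<noteq> 0 \<and> (\<forall>s\<in>S. dir b * s \<le> int n)) \<and>
       (if e then \<exists>s\<in>S. dir b * s < 0 else \<forall>s\<in>S. 0 \<le> dir b * s))"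

lemma tracks_nonempty: "tracks q \<gamma> s \<Longrightarrow> \<gamma> \<noteq> []"
proof -
  have "lamp_stack S b n \<noteq> []" for S b n by (cases n) auto
  then show "tracks q \<gamma> s \<Longrightarrow> \<gamma> \<noteq> []" by (cases s; cases q) auto
qed

text \<open>Each refusal of \<open>delta\<close> matches one clause of \<open>allowed\<close>:
  switching consults \<open>l\<close>, a step outwards \<open>i\<close>, a crossing of the origin
  \<open>e\<close>, and a step inwards \<open>i \<or> l\<close>.\<close>

lemma tracks_step:
  assumes "tracks q (Z # \<gamma>) s"
  shows "case delta q x Z of None \<Rightarrow> \<not> allowed s x
    | Some (q', \<beta>) \<Rightarrow> allowed s x \<and> tracks q' (\<beta> @ \<gamma>) (act s x)"
proof -
  obtain S k where s: "s = (S, k)" by (cases s)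
  obtain l z where Z: "Z = (l, z)" by (cases Z)
  show ?thesis
  proof (cases q)
    case Start
    with assms have "k = 0" "S \<subseteq> {0}" "l \<longleftrightarrow> 0 \<in> S" "z" "\<gamma> = []" by (auto simp: s Z)
    \<comment> \<open>The first step leads to distance 1, hence the witness
      \<open>Suc 0\<close>.\<close>
    then show ?thesis
      by (cases x) (auto simp: Start s Z intro!: exI[of _ "Suc 0"])
  next
    case (Going b i e)
    then obtain n where k: "k = dir b * int n" and st: "lamp_stack S b n = (l, z) # \<gamma>"
      and i: "if i then \<exists>s\<in>S. int n < dir b * s else n \<noteq> 0 \<and> (\<forall>s\<in>S. dir b * s \<le> int n)"
      and e: "if e then \<exists>s\<in>S. dir b * s < 0 else \<forall>s\<in>S. 0 \<le> dir b * s"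
      using assms by (auto simp: s Z)
    have z: "z \<longleftrightarrow> n = 0" and l: "l \<longleftrightarrow> k \<in> S" using st k by (cases n; auto)+
    show ?thesis
    proof (cases x)
      case Switch
      have "tracks q ((True, z) # \<gamma>) (insert k S, k)"
        unfolding Going tracks.simps
        using i e lamp_stack_insert[OF st] by (intro exI[of _ n]) (auto simp: k)
      then show ?thesis by (simp add: Switch s Z l)
    next
      case (Step c)
      consider (out) "c = b" | (cross) "c = (\<not> b)" "n = 0" | (inw) m where "c = (\<not> b)" "n = Suc m"
        by (cases n) auto
      then show ?thesis
      proof cases
        case out
        show ?thesis
        proof (cases i)
          case True
          with i show ?thesis by (force simp: Going Step s Z out k)
        next
          case False
          \<comment> \<open>This justifies pushing an unlit symbol for the lamp now reached.\<close>
          with i have "dir b * int (Suc n) \<notin> S" by force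
          with False i e st show ?thesis
            by (force simp: Going Step s Z out k distrib_left intro!: exI[of _ "Suc n"])
        qed
      next
        case cross
        \<comment> \<open>At distance 0 the invariant leaves only the case \<open>i\<close>, so
          lamps are lit on the side being left; hence the last flag after the crossing is
          \<open>True\<close>.\<close>
        with i have i': "i" "\<exists>s\<in>S. 0 < dir b * s" by (cases i; simp)+
        show ?thesis
        proof (cases e)
          case True
          with e show ?thesis by (force simp: Going Step s Z cross k z)
        next
          case False
          with e have nn: "\<forall>s\<in>S. 0 \<le> dir b * s" by simp
          then have "- dir b \<notin> S" by force
          with nn i' st cross(2) False show ?thesis
            by (force simp: Going Step s Z cross(1) k z intro!: exI[of _ "Suc 0"])
        qed
      next
        case inw
        have lk: "l \<longleftrightarrow> dir b * int n \<in> S" using l k by simp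
        have ex: "i \<or> l \<longleftrightarrow> (\<exists>s\<in>S. int n \<le> dir b * s)"
        proof (cases i)
          case True
          with i show ?thesis by force
        next
          case False
          with i have "\<forall>s\<in>S. dir b * s \<le> int n" by simp
          then have "l" if "s \<in> S" "int n \<le> dir b * s" for s
          proof -
            from that \<open>\<forall>s\<in>S. dir b * s \<le> int n\<close> have "dir b * s = int n" by force
            then have "dir b * int n = s" by (metis dir_simps(5))
            with that lk show ?thesis by simp
          qed
          then show ?thesis using lk False by force
        qed
        have "n \<noteq> 0" using inw(2) by simp
        then have "allowed s x \<longleftrightarrow> i \<or> l"
          unfolding ex using inw(1) \<open>n \<noteq> 0\<close> by (simp add: s Step k)
        moreover have "tracks (Going b True e) \<gamma> (S, k - dir b)" if "i \<or> l"
        proof -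
          \<comment> \<open>A lamp at distance at least \<open>n = Suc m\<close> is strictly further
            out than the new position, so \<open>i\<close> becomes true when the symbol is
            popped.\<close>
          from that ex have "\<exists>s\<in>S. int m < dir b * s" using inw(2) by force
          then show ?thesis
            using e st inw(2) by (auto simp: k algebra_simps intro!: exI[of _ m])
        qed
        ultimately show ?thesis
          using inw by (simp add: Going Step s Z z)
      qed
    qed
  qed
qed

text \<open>The automaton is deterministic without silent moves, so a word is read to its end
  exactly when no letter is refused.\<close>

lemma lamp_pda_accepts:
  assumes "tracks q \<gamma> s"
  shows "(\<exists>p \<delta>. (pda_step lamp_pda)\<^sup>*\<^sup>* (q, w, \<gamma>) (p, [], \<delta>)) \<longleftrightarrow> admissible s w"
  using assms
proof (induction w arbitrary: q \<gamma> s)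
  case Nil
  show ?case by auto
next
  case (Cons x w)
  obtain Z \<gamma>' where \<gamma>: "\<gamma> = Z # \<gamma>'" using tracks_nonempty[OF Cons.prems] by (cases \<gamma>) auto
  have step: "pda_step lamp_pda (q, x # w, \<gamma>) c \<longleftrightarrow>
      (\<exists>q' \<beta>. delta q x Z = Some (q', \<beta>) \<and> c = (q', w, \<beta> @ \<gamma>'))" for c
    by (auto simp: \<gamma> lamp_pda_trans pda_step.simps)
  have "(\<exists>p \<delta>. (pda_step lamp_pda)\<^sup>*\<^sup>* (q, x # w, \<gamma>) (p, [], \<delta>)) \<longleftrightarrow>
      (\<exists>q' \<beta> p \<delta>. delta q x Z = Some (q', \<beta>) \<and>
        (pda_step lamp_pda)\<^sup>*\<^sup>* (q', w, \<beta> @ \<gamma>') (p, [], \<delta>))" (is "?l \<longleftrightarrow> ?r")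
  proof
    assume ?l
    then obtain p \<delta> where "(pda_step lamp_pda)\<^sup>*\<^sup>* (q, x # w, \<gamma>) (p, [], \<delta>)" by blast
    then show ?r by (cases rule: converse_rtranclpE) (auto simp: step)
  next
    assume ?r
    then obtain q' \<beta> p \<delta> where "delta q x Z = Some (q', \<beta>)"
      and steps: "(pda_step lamp_pda)\<^sup>*\<^sup>* (q', w, \<beta> @ \<gamma>') (p, [], \<delta>)"
      by blast
    then have "pda_step lamp_pda (q, x # w, \<gamma>) (q', w, \<beta> @ \<gamma>')" by (simp add: step)
    from this steps have "(pda_step lamp_pda)\<^sup>*\<^sup>* (q, x # w, \<gamma>) (p, [], \<delta>)"
      by (rule converse_rtranclp_into_rtranclp)
    then show ?l by blast
  qed
  also have "\<dots> \<longleftrightarrow> admissible s (x # w)"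
  proof (cases "delta q x Z")
    case None
    then show ?thesis using tracks_step[of q Z \<gamma>' s x] Cons.prems by (simp add: \<gamma>)
  next
    case (Some c)
    obtain q' \<beta> where "c = (q', \<beta>)" by (cases c)
    then show ?thesis
      using Some tracks_step[of q Z \<gamma>' s x] Cons.prems Cons.IH[of q' "\<beta> @ \<gamma>'" "act s x"]
      by (simp add: \<gamma>)
  qed
  finally show ?case .
qed

lemma lamp_pda_language: "pda_language lamp_pda = {w. admissible ({}, 0) w}"
proof -
  have "tracks Start [(False, True)] ({}, 0)" by simp
  from lamp_pda_accepts[OF this] show ?thesis
    by (auto simp: pda_language_def lamp_pda_def)
qed

section \<open>The presentation\<close>

text \<open>The exponent of \<open>gen_a\<close> is dropped because switching undoes itself.\<close>

fun lamp_letter_of :: "L2_gen \<times> bool \<Rightarrow> lamp_letter" where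
  "lamp_letter_of (gen_a, e) = Switch"
| "lamp_letter_of (gen_t, e) = Step e"

definition run :: "lamps \<Rightarrow> L2_gen gword \<Rightarrow> lamps" where
  "run s w = foldl act s (map lamp_letter_of w)"

lemma run_Nil [simp]: "run s [] = s"
  and run_Cons [simp]: "run s (x # w) = run (act s (lamp_letter_of x)) w"
  and run_append [simp]: "run s (u @ v) = run (run s u) v"
  by (simp_all add: run_def)

lemma run_power [simp]: "run (S, k) (gword_power gen_t i) = (S, k + i)"
proof -
  have "run (S, k) (replicate n (gen_t, b)) = (S, k + dir b * int n)" for n b
    by (induction n arbitrary: k) (auto simp: algebra_simps)
  then show ?thesis by (simp add: gword_power_def dir_def)
qed

lemma gword_inv_append [simp]: "gword_inv (u @ v) = gword_inv v @ gword_inv u"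
  by (simp add: gword_inv_def)

lemma gword_inv_Cons [simp]: "gword_inv ((x, b) # w) = gword_inv w @ [(x, \<not> b)]"
  by (simp add: gword_inv_def)

lemma gword_inv_power [simp]: "gword_inv (gword_power x i) = gword_power x (- i)"
  by (cases "i = 0") (auto simp: gword_inv_def gword_power_def)

text \<open>The lamplighter walks by \<open>i\<close>, switches and walks back. The set is the
  symmetric difference of \<open>S\<close> and \<open>{k + i}\<close>, written so that such toggles
  visibly commute and cancel.\<close>

lemma run_conj:
  "run (S, k) (L2_conj_word i) = ({j. j \<in> S \<longleftrightarrow> j \<noteq> k + i}, k)"
  "run (S, k) (gword_inv (L2_conj_word i)) = ({j. j \<in> S \<longleftrightarrow> j \<noteq> k + i}, k)"
proof -
  have "(if l \<in> S then S - {l} else insert l S) = {j. j \<in> S \<longleftrightarrow> j \<noteq> l}" for l by auto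
  then show "run (S, k) (L2_conj_word i) = ({j. j \<in> S \<longleftrightarrow> j \<noteq> k + i}, k)"
    "run (S, k) (gword_inv (L2_conj_word i)) = ({j. j \<in> S \<longleftrightarrow> j \<noteq> k + i}, k)"
    by (simp_all add: L2_conj_word_def)
qed

lemma run_relator:
  assumes "r \<in> L2_relators"
  shows "run s r = s"
proof -
  obtain S k where s: "s = (S, k)" by (cases s)
  have "gword_power gen_a 2 = [(gen_a, True), (gen_a, True)]"
    by (simp add: gword_power_def numeral_2_eq_2)
  moreover have "run s (gword_commutator (L2_conj_word i) (L2_conj_word j)) = s" for i j
    unfolding gword_commutator_def s run_append run_conj by auto
  ultimately show ?thesis using assms by (auto simp: L2_relators_def s)
qed

text \<open>Words act on configurations through the group, so words leading to different
  configurations represent different elements.\<close>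

lemma run_pres_eq:
  assumes "pres_eq L2_relators u v"
  shows "run s u = run s v"
  using assms
proof (induction arbitrary: s)
  case (pres_cancel u x e v)
  have "lamp_letter_of (x, \<not> e) = opposite (lamp_letter_of (x, e))" by (cases x) auto
  then show ?case by simp
qed (simp_all add: run_relator)

section \<open>Normal forms in the presented group\<close>

definition cls :: "L2_gen gword \<Rightarrow> L2_gen gword set" where
  "cls = pres_class L2_relators"

lemma group_L2: "group L2"
  by (simp add: L2_def group_presented_group)

interpretation L2: group L2
  by (rule group_L2)

lemma cls_closed [simp]: "cls w \<in> carrier L2"
  by (simp add: cls_def L2_def presented_group_carrier)

lemma cls_append: "cls (u @ v) = cls u \<otimes>\<^bsub>L2\<^esub> cls v"
  by (simp add: cls_def L2_def presented_group_mult)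

lemma cls_Nil: "cls [] = \<one>\<^bsub>L2\<^esub>"
  by (simp add: cls_def L2_def presented_group_one)

lemma cls_inv: "cls (gword_inv w) = inv\<^bsub>L2\<^esub> cls w"
  by (simp add: cls_def L2_def presented_group_inv)

lemma cls_relator: "r \<in> L2_relators \<Longrightarrow> cls r = \<one>\<^bsub>L2\<^esub>"
  by (simp add: cls_def L2_def presented_group_relator)

lemma cls_aa: "cls [(gen_a, True)] \<otimes>\<^bsub>L2\<^esub> cls [(gen_a, True)] = \<one>\<^bsub>L2\<^esub>"
proof -
  have "gword_power gen_a 2 = [(gen_a, True)] @ [(gen_a, True)]"
    by (simp add: gword_power_def numeral_2_eq_2)
  then show ?thesis
    using cls_relator[of "gword_power gen_a 2"] by (simp add: L2_relators_def flip: cls_append)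
qed

lemma cls_t_inv: "cls [(gen_t, False)] = inv\<^bsub>L2\<^esub> cls [(gen_t, True)]"
  using cls_inv[of "[(gen_t, True)]"] by (simp add: gword_inv_def)

lemma cls_power_minus: "cls (gword_power gen_t (- i)) = inv\<^bsub>L2\<^esub> cls (gword_power gen_t i)"
  using cls_inv[of "gword_power gen_t i"] by simp

lemma cls_power_Suc:
  "cls (gword_power gen_t (i + 1)) = cls (gword_power gen_t i) \<otimes>\<^bsub>L2\<^esub> cls [(gen_t, True)]"
proof (cases "0 \<le> i")
  case True
  then have "gword_power gen_t (i + 1) = gword_power gen_t i @ [(gen_t, True)]"
    by (simp add: gword_power_def nat_add_distrib replicate_append_same)
  then show ?thesis by (simp add: cls_append)
next
  case False
  then have "nat \<bar>i\<bar> = Suc (nat \<bar>i + 1\<bar>)" by simp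
  \<comment> \<open>For \<open>i = - 1\<close> the shorter power is empty and its sign flag flips,
    so this case is split off.\<close>
  with False have "gword_power gen_t i = gword_power gen_t (i + 1) @ [(gen_t, False)]"
    by (cases "i = - 1") (auto simp: gword_power_def replicate_append_same)
  then show ?thesis by (simp add: cls_append cls_t_inv L2.m_assoc)
qed

lemma cls_power_pred:
  "cls (gword_power gen_t (i - 1)) = cls (gword_power gen_t i) \<otimes>\<^bsub>L2\<^esub> cls [(gen_t, False)]"
  using cls_power_Suc[of "i - 1"] by (simp add: cls_t_inv L2.m_assoc)

abbreviation conj :: "int \<Rightarrow> L2_gen gword set" where
  "conj i \<equiv> cls (L2_conj_word i)"

lemma conj_eq:
  "conj i = cls (gword_power gen_t i) \<otimes>\<^bsub>L2\<^esub> cls [(gen_a, True)] \<otimes>\<^bsub>L2\<^esub>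
     inv\<^bsub>L2\<^esub> cls (gword_power gen_t i)"
  by (simp only: L2_conj_word_def cls_append cls_power_minus L2.m_assoc cls_closed L2.m_closed
      L2.inv_closed)

lemma power_switch:
  "cls (gword_power gen_t i) \<otimes>\<^bsub>L2\<^esub> cls [(gen_a, True)] = conj i \<otimes>\<^bsub>L2\<^esub> cls (gword_power gen_t i)"
  by (simp add: conj_eq L2.m_assoc)

lemma conj_conj: "conj i \<otimes>\<^bsub>L2\<^esub> conj i = \<one>\<^bsub>L2\<^esub>"
proof -
  let ?a = "cls [(gen_a, True)]" and ?t = "cls (gword_power gen_t i)"
  have "conj i \<otimes>\<^bsub>L2\<^esub> conj i = conj i \<otimes>\<^bsub>L2\<^esub> ?t \<otimes>\<^bsub>L2\<^esub> ?a \<otimes>\<^bsub>L2\<^esub> inv\<^bsub>L2\<^esub> ?t"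
    by (simp add: conj_eq flip: L2.m_assoc)
  also have "\<dots> = ?t \<otimes>\<^bsub>L2\<^esub> (?a \<otimes>\<^bsub>L2\<^esub> ?a) \<otimes>\<^bsub>L2\<^esub> inv\<^bsub>L2\<^esub> ?t"
    by (simp add: L2.m_assoc flip: power_switch)
  finally show ?thesis by (simp add: cls_aa)
qed

text \<open>Both factors are involutions, so the commutator relator says that their product is one
  too; inverting the product reverses its factors.\<close>

lemma conj_commute: "conj i \<otimes>\<^bsub>L2\<^esub> conj j = conj j \<otimes>\<^bsub>L2\<^esub> conj i"
proof -
  have "conj i \<otimes>\<^bsub>L2\<^esub> (conj j \<otimes>\<^bsub>L2\<^esub> (inv\<^bsub>L2\<^esub> conj i \<otimes>\<^bsub>L2\<^esub> inv\<^bsub>L2\<^esub> conj j)) = \<one>\<^bsub>L2\<^esub>"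
    using cls_relator[of "gword_commutator (L2_conj_word i) (L2_conj_word j)"]
    by (auto simp: L2_relators_def gword_commutator_def cls_append cls_inv)
  moreover have "inv\<^bsub>L2\<^esub> conj l = conj l" for l
    by (rule L2.inv_equality) (simp_all add: conj_conj)
  ultimately have "conj i \<otimes>\<^bsub>L2\<^esub> conj j \<otimes>\<^bsub>L2\<^esub> (conj i \<otimes>\<^bsub>L2\<^esub> conj j) = \<one>\<^bsub>L2\<^esub>"
    by (simp add: L2.m_assoc)
  then have "inv\<^bsub>L2\<^esub> (conj i \<otimes>\<^bsub>L2\<^esub> conj j) = conj i \<otimes>\<^bsub>L2\<^esub> conj j"
    by (intro L2.inv_equality) simp_all
  then show ?thesis
    using \<open>\<And>l. inv\<^bsub>L2\<^esub> conj l = conj l\<close> by (simp add: L2.inv_mult_group)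
qed

definition conjs :: "int list \<Rightarrow> L2_gen gword set" where
  "conjs is = foldr (\<lambda>i g. conj i \<otimes>\<^bsub>L2\<^esub> g) is \<one>\<^bsub>L2\<^esub>"

lemma conjs_Nil [simp]: "conjs [] = \<one>\<^bsub>L2\<^esub>"
  and conjs_Cons [simp]: "conjs (i # is) = conj i \<otimes>\<^bsub>L2\<^esub> conjs is"
  by (simp_all add: conjs_def)

lemma conjs_closed [simp]: "conjs is \<in> carrier L2"
  by (induction "is") simp_all

lemma conj_conjs: "conj i \<otimes>\<^bsub>L2\<^esub> conjs is = conjs is \<otimes>\<^bsub>L2\<^esub> conj i"
proof (induction "is")
  case (Cons j js)
  have "conj i \<otimes>\<^bsub>L2\<^esub> conjs (j # js) = conj j \<otimes>\<^bsub>L2\<^esub> (conj i \<otimes>\<^bsub>L2\<^esub> conjs js)"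
    by (simp add: conj_commute[of i j] flip: L2.m_assoc)
  then show ?case by (simp add: Cons L2.m_assoc)
qed simp

lemma conjs_insort: "conjs (insort i is) = conjs is \<otimes>\<^bsub>L2\<^esub> conj i"
proof (induction "is")
  case (Cons j js)
  then show ?case using conj_conjs[of i "j # js"] by (simp add: L2.m_assoc)
qed simp

text \<open>Since \<open>conj i\<close> is an involution that commutes with the others, multiplying
  by it again deletes its factor.\<close>

lemma conjs_remove:
  assumes "finite S" "i \<in> S"
  shows "conjs (sorted_list_of_set (S - {i})) = conjs (sorted_list_of_set S) \<otimes>\<^bsub>L2\<^esub> conj i"
proof -
  have "sorted_list_of_set S = insort i (sorted_list_of_set (S - {i}))"
    using assms sorted_list_of_set.sorted_key_list_of_set_insert_remove[of S i]
    by (simp add: insert_absorb)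
  then show ?thesis by (simp add: conjs_insort conj_conj L2.m_assoc)
qed

fun gletter :: "lamp_letter \<Rightarrow> L2_gen \<times> bool" where
  "gletter Switch = (gen_a, True)"
| "gletter (Step b) = (gen_t, b)"

lemma lamp_letter_of_gletter [simp]: "lamp_letter_of (gletter x) = x"
  by (cases x) auto

definition normal_form :: "lamps \<Rightarrow> L2_gen gword set" where
  "normal_form s = conjs (sorted_list_of_set (fst s)) \<otimes>\<^bsub>L2\<^esub> cls (gword_power gen_t (snd s))"

text \<open>For \<open>Switch\<close>, \<open>power_switch\<close> carries the generator past the
  power of \<open>t\<close> as \<open>conj k\<close>, which the sorted product absorbs or
  cancels.\<close>

lemma normal_form_act:
  assumes "finite (fst s)"
  shows "normal_form s \<otimes>\<^bsub>L2\<^esub> cls [gletter x] = normal_form (act s x)"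
proof (cases x)
  case Switch
  obtain S k where s: "s = (S, k)" by (cases s)
  have "normal_form s \<otimes>\<^bsub>L2\<^esub> cls [gletter x] =
      conjs (sorted_list_of_set S) \<otimes>\<^bsub>L2\<^esub> conj k \<otimes>\<^bsub>L2\<^esub> cls (gword_power gen_t k)"
    by (simp add: normal_form_def s Switch L2.m_assoc power_switch)
  then show ?thesis
    using assms
    by (simp add: normal_form_def s Switch conjs_remove conjs_insort
        sorted_list_of_set.sorted_key_list_of_set_insert)
next
  case (Step b)
  then show ?thesis
    by (cases s; cases b) (simp_all add: normal_form_def L2.m_assoc cls_power_Suc cls_power_pred)
qed

lemma cls_normal_form: "cls (map gletter w) = normal_form (foldl act ({}, 0) w)"
proof (induction w rule: rev_induct)
  case Nil
  show ?case by (simp add: normal_form_def gword_power_def cls_Nil)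
next
  case (snoc x w)
  then show ?case by (simp add: cls_append normal_form_act)
qed

text \<open>The action separates elements, and the normal form shows that the configuration
  determines the element.\<close>

lemma cls_eq_iff:
  "cls (map gletter u) = cls (map gletter v) \<longleftrightarrow> foldl act ({}, 0) u = foldl act ({}, 0) v"
proof
  assume "cls (map gletter u) = cls (map gletter v)"
  then have "pres_eq L2_relators (map gletter u) (map gletter v)"
    by (simp add: cls_def pres_class_eq_iff)
  from run_pres_eq[OF this, of "({}, 0)"]
  show "foldl act ({}, 0) u = foldl act ({}, 0) v" by (simp add: run_def comp_def)
next
  assume "foldl act ({}, 0) u = foldl act ({}, 0) v"
  then show "cls (map gletter u) = cls (map gletter v)" by (simp add: cls_normal_form)
qed

section \<open>Geodesics\<close>

definition elt :: "lamp_letter \<Rightarrow> L2_gen gword set" where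
  "elt x = cls [gletter x]"

lemma letters_L2: "letters L2 {L2_a, L2_t} = range elt"
proof -
  have "inv\<^bsub>L2\<^esub> L2_a = L2_a"
    using cls_aa by (intro L2.inv_equality) (simp_all add: L2_a_def flip: cls_def)
  moreover have "L2_a = elt Switch" "L2_t = elt (Step True)" "inv\<^bsub>L2\<^esub> L2_t = elt (Step False)"
    by (simp_all add: elt_def L2_a_def L2_t_def cls_t_inv flip: cls_def)
  ultimately show ?thesis
    by (auto simp: letters_def UNIV_lamp_letter UNIV_bool image_image)
qed

lemma word_value_elt: "word_value L2 (map elt w) = cls (map gletter w)"
proof (induction w)
  case Nil
  show ?case by (simp add: word_value_def cls_Nil)
next
  case (Cons x w)
  have "cls (map gletter (x # w)) = elt x \<otimes>\<^bsub>L2\<^esub> cls (map gletter w)"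
    using cls_append[of "[gletter x]" "map gletter w"] by (simp only: elt_def list.map append.simps)
  with Cons show ?case by (simp add: word_value_def)
qed

text \<open>\<open>ex_word_of_len\<close> supplies a word of this length, and \<open>len_run\<close>
  excludes shorter ones.\<close>

lemma word_length_elt:
  "word_length L2 {L2_a, L2_t} (word_value L2 (map elt w)) = nat (len (foldl act ({}, 0) w))"
  (is "_ = nat (len ?s)")
  unfolding word_length_def
proof (rule Least_equality)
  obtain v where v: "foldl act ({}, 0) v = ?s" "int (length v) = len ?s"
    using ex_word_of_len[of ?s] by auto
  then have "word_value L2 (map elt v) = word_value L2 (map elt w)"
    by (simp add: word_value_elt cls_eq_iff)
  moreover have "length v = nat (len ?s)" using v(2) by simp
  ultimately show "\<exists>u\<in>lists (letters L2 {L2_a, L2_t}).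
      word_value L2 u = word_value L2 (map elt w) \<and> length u = nat (len ?s)"
    by (intro bexI[of _ "map elt v"]) (simp_all add: letters_L2 lists_image)
next
  fix n assume "\<exists>u\<in>lists (letters L2 {L2_a, L2_t}).
      word_value L2 u = word_value L2 (map elt w) \<and> length u = n"
  then obtain v where "word_value L2 (map elt v) = word_value L2 (map elt w)" "length v = n"
    by (auto simp: letters_L2 lists_image)
  then show "nat (len ?s) \<le> n"
    using len_run(1)[of "({}, 0)" v] by (simp add: word_value_elt cls_eq_iff)
qed

lemma geodesics_L2: "geodesics L2 {L2_a, L2_t} = map elt ` {w. admissible ({}, 0) w}"
proof -
  \<comment> \<open>\<open>ex_word_of_len\<close> serves here to make \<open>len\<close>
    nonnegative, so that \<open>nat\<close> loses nothing.\<close>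
  have "length w = nat (len (foldl act ({}, 0) w)) \<longleftrightarrow> admissible ({}, 0) w" for w
    using len_run[of "({}, 0)" w] ex_word_of_len[of "foldl act ({}, 0) w"] by auto
  then show ?thesis
    by (auto simp: geodesics_def letters_L2 lists_image word_length_elt)
qed

theorem theorem18: "context_free (geodesics L2 {L2_a, L2_t})"
  using context_free_map[OF is_pda_lamp_pda, of elt]
  by (simp add: geodesics_L2 lamp_pda_language)

end
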